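(* Let $\mu>0$, let $f\in\mathcal{S}_{\mu}(\mathbb{R}^{d_1})$, $g\in\mathcal{F}(\mathbb{R}^{d_2})$, $F\in\mathbb{R}^{d_2\times d_1}$, let $s>0$ with $s^2\in(0,\|F\|^{-2})$, and let $c\in(0,\mu)$. Let $(x^{\star},y^{\star})$ be a saddle point of $\Phi(x,y)=f(x)+\langle Fx,y\rangle-g^{\star}(y)$. Let $\{(x_k,y_k)\}_{k\ge0}$ be generated from arbitrary $(x_0,y_0)\in\mathbb{R}^{d_1}\times\mathbb{R}^{d_2}$ by the PDHG algorithm with step sizes $$\tau_k=\frac{1}{ck}\ \ (k\ge 1),\qquad \sigma_k=cs^2(k+1)\ \ (k\ge 0),$$ with $\tau_0>\tau_1=1/c$ an arbitrary real number, and with $\theta_k=\tau_{k+1}/\tau_k\in(0,1)$ for all $k\ge0$ (so that $\tau_{k+1}\sigma_k=s^2$ for all $k\ge 0$). For $k\ge 1$ define $$\mathcal{E}(k)=\frac{\|x_k-x^{\star}\|^2}{2\tau_k^2}+\frac{\|y_{k-1}-y^{\star}\|^2}{2s^2}+\frac{\langle F(x_k-x_{k-1}),y_{k-1}-y^{\star}\rangle}{\tau_{k-1}}+\frac{\|x_k-x_{k-1}\|^2}{2\tau_{k-1}^2}.$$ Let $K_0=\left\lceil\frac{c}{2\mu-2c}\right\rceil$, which is a positive integer. Then for every $k\ge K_0$, $$\|x_k-x^{\star}\|^2\le\frac{2\mathcal{E}(K_0)}{c^2k^2}.$$ Specifically, if $c\le\frac{2\mu}{3}$, then for every $k\ge 1$,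 $$\|x_k-x^{\star}\|^2\le\frac{2}{c^2k^2}\left(\frac{\|x_1-x^{\star}\|^2}{2\tau_1^2}+\frac{\|y_0-y^{\star}\|^2}{2s^2}+\frac{\langle F(x_1-x_0),y_0-y^{\star}\rangle}{\tau_0}+\frac{\|x_1-x_0\|^2}{2\tau_0^2}\right).$$
   Context: Notation. $\|\cdot\|$ is the Euclidean norm on vectors and the induced operator (spectral) norm on matrices. $\mathcal{F}(\mathbb{R}^d)$ is the class of proper, lower semi-continuous, convex functions $\mathbb{R}^d\to(-\infty,\infty]$. A vector $v$ is a subgradient of a convex $f$ at $x\in\mathrm{dom}(f)$ if $f(y)\ge f(x)+\langle v,y-x\rangle$ for all $y$; $\partial f(x)$ is the set of subgradients. $\mathcal{S}_{\mu}(\mathbb{R}^d)\subset\mathcal{F}(\mathbb{R}^d)$ is the class of $\mu$-strongly convex functions: $f(y)\ge f(x)+\langle v,y-x\rangle+\frac{\mu}{2}\|y-x\|^2$ for all $x,y$ and all $v\in\partial f(x)$. The conjugate of $g$ is $g^{\star}(y)=\sup_{x}(\langle y,x\rangle-g(x))$. A saddle point of $\Phi$ is a pair $(x^{\star},y^{\star})$ with $\Phi(x^{\star},y)\le\Phi(x^{\star},y^{\star})\le\Phi(x,y^{\star})$ for all $x\in\mathbb{R}^{d_1}$, $y\in\mathbb{R}^{d_2}$; for $\Phi(x,y)=f(x)+\langle Fx,y\rangle-g^{\star}(y)$ this is equivalent to $-F^{\top}y^{\star}\in\partial f(x^{\star})$ and $Fx^{\star}\in\partial g^{\star}(y^{\star})$.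 PDHG algorithm with parameters $\tau_k,\sigma_k>0$ and $\theta_k\in(0,1]$: for $k=0,1,2,\dots$, $$x_{k+1}=\operatorname{argmin}_{x\in\mathbb{R}^{d_1}}\Big\{f(x)+\langle Fx,y_k\rangle+\tfrac{1}{2\tau_k}\|x-x_k\|^2\Big\},$$ $$\overline{x}_{k+1}=x_{k+1}+\theta_k(x_{k+1}-x_k),$$ $$y_{k+1}=\operatorname{argmax}_{y\in\mathbb{R}^{d_2}}\Big\{-g^{\star}(y)+\langle F\overline{x}_{k+1},y\rangle-\tfrac{1}{2\sigma_k}\|y-y_k\|^2\Big\}.$$ *)

theory Defs
  imports "HOL-Analysis.Analysis"
begin

definition proper_fun :: "('a \<Rightarrow> ereal) \<Rightarrow> bool" where
  "proper_fun f \<longleftrightarrow> (\<forall>x. f x \<noteq> - \<infinity>) \<and> (\<exists>x. f x \<noteq> \<infinity>)"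

definition lsc_fun :: "('a::topological_space \<Rightarrow> ereal) \<Rightarrow> bool" where
  "lsc_fun f \<longleftrightarrow> (\<forall>x. f x \<le> Liminf (at x) f)"

text \<open>The library's \<^const>\<open>convex_on\<close> only covers real-valued functions.  In
  \<^typ>\<open>ereal\<close> one has \<open>0 * \<infinity> = 0\<close>, so the end points \<open>u = 0\<close> and \<open>v = 0\<close> are harmless.\<close>

definition convex_fun :: "('a::real_vector \<Rightarrow> ereal) \<Rightarrow> bool" where
  "convex_fun f \<longleftrightarrow> (\<forall>x y. \<forall>u\<ge>0. \<forall>v\<ge>0. u + v = 1 \<longrightarrow>
     f (u *\<^sub>R x + v *\<^sub>R y) \<le> ereal u * f x + ereal v * f y)"

definition closed_convex_funs :: "('a::euclidean_space \<Rightarrow> ereal) set" where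
  "closed_convex_funs = {f. proper_fun f \<and> lsc_fun f \<and> convex_fun f}"

text \<open>The subdifferential is empty outside the effective domain \<open>{x. f x < \<infinity>}\<close>.\<close>

definition subdiff :: "('a::real_inner \<Rightarrow> ereal) \<Rightarrow> 'a \<Rightarrow> 'a set" where
  "subdiff f x = {v. f x < \<infinity> \<and> (\<forall>y. f y \<ge> f x + ereal (v \<bullet> (y - x)))}"

definition strongly_convex_funs :: "real \<Rightarrow> ('a::euclidean_space \<Rightarrow> ereal) set" where
  "strongly_convex_funs \<mu> = {f \<in> closed_convex_funs.
     \<forall>x y. \<forall>v \<in> subdiff f x. f y \<ge> f x + ereal (v \<bullet> (y - x) + \<mu> / 2 * (norm (y - x))\<^sup>2)}"

definition convex_conjugate :: "('a::real_inner \<Rightarrow> ereal) \<Rightarrow> 'a \<Rightarrow> ereal" where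
  "convex_conjugate g y = (SUP x. ereal (y \<bullet> x) - g x)"

text \<open>\<^typ>\<open>ereal\<close> sets \<open>\<infinity> - \<infinity> = \<infinity>\<close>, so \<open>\<Phi>\<close> takes the value \<open>\<infinity>\<close> whenever \<open>f x = \<infinity>\<close>.  For
  \<open>f\<close> and \<open>g\<close> in \<open>closed_convex_funs\<close> the choice does not matter for saddle points: either
  convention forces \<open>f x\<close> and \<open>convex_conjugate g y\<close> to be finite at a saddle point \<open>(x, y)\<close>, and
  then the indeterminate form never occurs in the inequalities defining it.\<close>

definition lagrangian ::
  "(real^'n \<Rightarrow> ereal) \<Rightarrow> (real^'m \<Rightarrow> ereal) \<Rightarrow> real^'n^'m \<Rightarrow> real^'n \<Rightarrow> real^'m \<Rightarrow> ereal" where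
  "lagrangian f g F x y = f x + ereal ((F *v x) \<bullet> y) - convex_conjugate g y"

definition saddle_point :: "('a \<Rightarrow> 'b \<Rightarrow> ereal) \<Rightarrow> 'a \<Rightarrow> 'b \<Rightarrow> bool" where
  "saddle_point \<Phi> xs ys \<longleftrightarrow> (\<forall>x y. \<Phi> xs y \<le> \<Phi> xs ys \<and> \<Phi> xs ys \<le> \<Phi> x ys)"

definition pdhg ::
  "(real^'n \<Rightarrow> ereal) \<Rightarrow> (real^'m \<Rightarrow> ereal) \<Rightarrow> real^'n^'m \<Rightarrow>
   (nat \<Rightarrow> real) \<Rightarrow> (nat \<Rightarrow> real) \<Rightarrow> (nat \<Rightarrow> real) \<Rightarrow>
   (nat \<Rightarrow> real^'n) \<Rightarrow> (nat \<Rightarrow> real^'m) \<Rightarrow> bool" where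
  "pdhg f g F \<tau> \<sigma> \<theta> x y \<longleftrightarrow> (\<forall>k.
     is_arg_min (\<lambda>u. f u + ereal ((F *v u) \<bullet> y k + 1 / (2 * \<tau> k) * (norm (u - x k))\<^sup>2))
       (\<lambda>_. True) (x (Suc k)) \<and>
     (let xbar = x (Suc k) + \<theta> k *\<^sub>R (x (Suc k) - x k) in
      is_arg_max (\<lambda>v. - convex_conjugate g v
          + ereal ((F *v xbar) \<bullet> v - 1 / (2 * \<sigma> k) * (norm (v - y k))\<^sup>2))
        (\<lambda>_. True) (y (Suc k))))"

text \<open>Meant for \<open>k \<ge> 1\<close> only; at \<open>k = 0\<close> the truncated subtraction makes it meaningless.\<close>

definition energy ::
  "real^'n^'m \<Rightarrow> real \<Rightarrow> (nat \<Rightarrow> real) \<Rightarrow> real^'n \<Rightarrow> real^'m \<Rightarrow>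
   (nat \<Rightarrow> real^'n) \<Rightarrow> (nat \<Rightarrow> real^'m) \<Rightarrow> nat \<Rightarrow> real" where
  "energy F s \<tau> xs ys x y k =
     (norm (x k - xs))\<^sup>2 / (2 * (\<tau> k)\<^sup>2)
     + (norm (y (k - 1) - ys))\<^sup>2 / (2 * s\<^sup>2)
     + ((F *v (x k - x (k - 1))) \<bullet> (y (k - 1) - ys)) / \<tau> (k - 1)
     + (norm (x k - x (k - 1)))\<^sup>2 / (2 * (\<tau> (k - 1))\<^sup>2)"

end

theory Submission
  imports Defs
begin

text \<open>The optimality conditions of the two proximal steps and of the saddle point are subgradient
  inclusions.  Strong monotonicity of \<open>\<partial>f\<close> at \<open>x\<^sub>k\<^sub>+\<^sub>1\<close> and monotonicity of the subdifferential of
  the conjugate at \<open>y\<^sub>k\<close> add up to \<open>E(k + 1) \<le> E(k)\<close>, provided that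
  \<open>1 / \<tau>\<^sub>k\<^sub>+\<^sub>1\<^sup>2 \<le> 1 / \<tau>\<^sub>k\<^sup>2 + 2\<mu> / \<tau>\<^sub>k\<close>; for \<open>\<tau>\<^sub>k = 1 / (c k)\<close> this says \<open>k \<ge> c / (2\<mu> - 2c)\<close>.
  Since \<open>s \<parallel>F\<parallel> \<le> 1\<close>, Young's inequality makes the last three terms of \<open>E(k)\<close> jointly
  nonnegative, so \<open>E(k)\<close> bounds its first term.\<close>

section \<open>Affine minorants and conjugates of extended-real convex functions\<close>

lemma convex_epigraph:
  assumes "convex_fun f"
  shows "convex {(x, t). f x \<le> ereal t}"
proof (rule convexI, clarsimp)
  fix a b :: 'a and p q u v :: real
  assume a: "f a \<le> ereal p" and b: "f b \<le> ereal q" and uv: "0 \<le> u" "0 \<le> v" "u + v = 1"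
  have "f (u *\<^sub>R a + v *\<^sub>R b) \<le> ereal u * f a + ereal v * f b"
    using assms uv by (auto simp: convex_fun_def)
  also have "\<dots> \<le> ereal u * ereal p + ereal v * ereal q"
    using a b uv by (intro add_mono ereal_mult_left_mono) auto
  finally show "f (u *\<^sub>R a + v *\<^sub>R b) \<le> ereal (u * p + v * q)" by simp
qed

text \<open>Semicontinuity at one point \<open>x\<^sub>0\<close> of the domain keeps \<open>(x\<^sub>0, f x\<^sub>0 - 1)\<close> away from the
  closure of the epigraph; a hyperplane separating the two is not vertical because \<open>(x\<^sub>0, f x\<^sub>0)\<close> lies on
  the other side.\<close>

lemma closed_convex_affine_minorant:
  assumes "f \<in> closed_convex_funs"
  obtains a b where "\<And>x. ereal (a \<bullet> x + b) \<le> f x"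
proof -
  have proper: "proper_fun f" and lsc: "lsc_fun f" and conv: "convex_fun f"
    using assms by (auto simp: closed_convex_funs_def)
  obtain x0 where "f x0 \<noteq> \<infinity>" "f x0 \<noteq> -\<infinity>"
    using proper by (auto simp: proper_fun_def)
  then obtain r where r: "f x0 = ereal r" by (cases "f x0") auto
  define E where "E = {(x, t). f x \<le> ereal t}"
  have "ereal (r - 1/2) < Liminf (at x0) f"
  proof (rule less_le_trans)
    show "ereal (r - 1/2) < ereal r" by simp
    show "ereal r \<le> Liminf (at x0) f" using lsc r unfolding lsc_fun_def by metis
  qed
  then have "eventually (\<lambda>x. ereal (r - 1/2) < f x) (at x0)"
    using less_LiminfD by blast
  then obtain U where U: "open U" "x0 \<in> U" "\<And>x. x \<in> U \<Longrightarrow> x \<noteq> x0 \<Longrightarrow> ereal (r - 1/2) < f x"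
    by (auto simp: eventually_at_topological)
  \<comment> \<open>The filter \<open>at x0\<close> leaves out \<open>x0\<close> itself, where the
    bound follows from \<open>f x0 = r\<close>.\<close>
  have U': "ereal (r - 1/2) < f x" if "x \<in> U" for x
    using U(3)[OF that] r by (cases "x = x0") auto
  have "(U \<times> {..<r - 1/2}) \<inter> E = {}"
  proof -
    have False if "x \<in> U" "t < r - 1/2" "f x \<le> ereal t" for x t
    proof -
      have "ereal (r - 1/2) < ereal t" using U'[OF that(1)] that(3) by (rule less_le_trans)
      then show False using that(2) by simp
    qed
    then show ?thesis by (auto simp: E_def)
  qed
  then have "(U \<times> {..<r - 1/2}) \<inter> closure E = {}"
    using U(1) by (simp add: open_Int_closure_eq_empty open_Times)
  moreover have "(x0, r - 1) \<in> U \<times> {..<r - 1/2}" using U(2) by simp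
  ultimately have nin: "(x0, r - 1) \<notin> closure E" by blast
  have "convex (closure E)"
    unfolding E_def by (intro convex_closure convex_epigraph conv)
  from separating_hyperplane_closed_point[OF this closed_closure nin]
  obtain w \<beta> where w: "w \<bullet> (x0, r - 1) < \<beta>" "\<And>z. z \<in> closure E \<Longrightarrow> \<beta> < w \<bullet> z"
    by blast
  obtain a d where ad: "w = (a, d)" by (cases w)
  have E: "\<beta> < a \<bullet> x + d * t" if "f x \<le> ereal t" for x t
    using w(2)[of "(x, t)"] that closure_subset[of E] by (auto simp: E_def ad)
  have lt: "a \<bullet> x0 + d * (r - 1) < \<beta>" using w(1) by (simp add: ad)
  have d: "d > 0" using lt E[of x0 r] r by (simp add: algebra_simps)
  show thesis
  proof
    fix x
    \<comment> \<open>The minorant is \<open>\<beta> < a \<bullet> x + d * t\<close> solved for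
      \<open>t = f x\<close>, which is possible because \<open>d > 0\<close>.\<close>
    show "ereal ((- a /\<^sub>R d) \<bullet> x + \<beta> / d) \<le> f x"
    proof (cases "f x")
      case (real t)
      then show ?thesis using E[of x t] d by (simp add: field_simps)
    next
      case MInf
      then show ?thesis using proper by (auto simp: proper_fun_def)
    qed auto
  qed
qed

text \<open>A point where \<open>g\<close> is finite bounds the conjugate from below everywhere. If
  \<open>a \<bullet> x + b\<close> is an affine minorant of \<open>g\<close>, the conjugate is at
  most \<open>- b\<close> at the slope \<open>a\<close>.\<close>

lemma convex_conjugate_proper:
  assumes "g \<in> closed_convex_funs"
  shows "proper_fun (convex_conjugate g)"
proof -
  have proper: "proper_fun g" using assms by (auto simp: closed_convex_funs_def)
  obtain x0 where "g x0 \<noteq> \<infinity>" "g x0 \<noteq> -\<infinity>"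
    using proper by (auto simp: proper_fun_def)
  then obtain r where r: "g x0 = ereal r" by (cases "g x0") auto
  have "convex_conjugate g y \<noteq> -\<infinity>" for y
  proof -
    have "ereal (y \<bullet> x0) - g x0 \<le> convex_conjugate g y"
      unfolding convex_conjugate_def by (rule SUP_upper) simp
    then show ?thesis using r by auto
  qed
  moreover obtain a b where ab: "\<And>x. ereal (a \<bullet> x + b) \<le> g x"
    using closed_convex_affine_minorant[OF assms] by blast
  have "convex_conjugate g a \<le> ereal (- b)"
    unfolding convex_conjugate_def
  proof (rule SUP_least)
    fix x show "ereal (a \<bullet> x) - g x \<le> ereal (- b)"
      using ab[of x] by (cases "g x") auto
  qed
  then have "convex_conjugate g a \<noteq> \<infinity>" by auto
  ultimately show ?thesis by (auto simp: proper_fun_def)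
qed

lemma convex_conjugate_convex: "convex_fun (convex_conjugate g)"
  unfolding convex_fun_def
proof (intro allI impI)
  fix y z :: 'a and u v :: real
  assume uv: "0 \<le> u" "0 \<le> v" "u + v = 1"
  show "convex_conjugate g (u *\<^sub>R y + v *\<^sub>R z)
    \<le> ereal u * convex_conjugate g y + ereal v * convex_conjugate g z"
    unfolding convex_conjugate_def[of g "u *\<^sub>R y + v *\<^sub>R z"]
  proof (rule SUP_least)
    fix x
    have le: "ereal (w \<bullet> x) - g x \<le> convex_conjugate g w" for w
      unfolding convex_conjugate_def by (rule SUP_upper) simp
    have mono: "ereal u * (ereal (y \<bullet> x) - g x) + ereal v * (ereal (z \<bullet> x) - g x)
      \<le> ereal u * convex_conjugate g y + ereal v * convex_conjugate g z"
      using le uv by (intro add_mono ereal_mult_left_mono) auto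
    show "ereal ((u *\<^sub>R y + v *\<^sub>R z) \<bullet> x) - g x
      \<le> ereal u * convex_conjugate g y + ereal v * convex_conjugate g z"
    proof (cases "g x")
      case (real r)
      have "(u *\<^sub>R y + v *\<^sub>R z) \<bullet> x - r = u * (y \<bullet> x - r) + v * (z \<bullet> x - r)"
      proof -
        have v: "v = 1 - u" using uv(3) by simp
        show ?thesis unfolding v by (simp add: inner_simps algebra_simps)
      qed
      then show ?thesis using mono real by simp
    next
      case PInf
      then show ?thesis by simp
    next
      \<comment> \<open>Here the conjugate is \<open>\<infinity>\<close> everywhere. Since
        \<open>0 * \<infinity> = 0\<close>, the right-hand side is \<open>\<infinity>\<close> only
        because one of the two weights is positive.\<close>
      case MInf
      have top: "convex_conjugate g w = \<infinity>" for w
        using le[of w] MInf by simp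
      have "u > 0 \<or> v > 0" using uv by linarith
      then show ?thesis using uv unfolding top by (cases "u = 0"; cases "v = 0") auto
    qed
  qed
qed

section \<open>Subgradient conditions for proximal steps and saddle points\<close>

text \<open>Fermat's rule for \<open>h\<close> plus a quadratic, meant for both \<open>f\<close> and
  the conjugate. Compare \<open>p\<close> with \<open>p + t (u - p)\<close>, bound \<open>h\<close>
  there by convexity and divide by \<open>t\<close>; the quadratic remainder vanishes as
  \<open>t\<close> tends to \<open>0\<close> from the right.\<close>

lemma arg_min_prox_subdiff:
  fixes h :: "'a::real_inner \<Rightarrow> ereal"
  assumes proper: "proper_fun h" and conv: "convex_fun h"
    and argmin: "is_arg_min (\<lambda>u. h u + ereal (w \<bullet> u + \<rho> / 2 * (norm (u - z))\<^sup>2)) (\<lambda>_. True) p"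
  shows "- w - \<rho> *\<^sub>R (p - z) \<in> subdiff h p"
proof -
  define q where "q u = w \<bullet> u + \<rho> / 2 * (norm (u - z))\<^sup>2" for u
  have le: "h p + ereal (q p) \<le> h u + ereal (q u)" for u
    using argmin by (auto simp: is_arg_min_def q_def not_less)
  obtain x0 where "h x0 \<noteq> \<infinity>" using proper by (auto simp: proper_fun_def)
  then have "h p \<noteq> \<infinity>" using le[of x0] by (cases "h x0") auto
  then obtain r where r: "h p = ereal r"
    using proper by (cases "h p") (auto simp: proper_fun_def)
  have "h p + ereal ((- w - \<rho> *\<^sub>R (p - z)) \<bullet> (u - p)) \<le> h u" for u
  proof (cases "h u")
    case (real m)
    define d where "d = u - p"
    define D where "D = (w + \<rho> *\<^sub>R (p - z)) \<bullet> d"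
    have bound: "0 \<le> (m - r + D) + t * (\<rho> / 2 * (norm d)\<^sup>2)" if t: "0 < t" "t < 1" for t
    proof -
      have "h ((1 - t) *\<^sub>R p + t *\<^sub>R u) \<le> ereal (1 - t) * h p + ereal t * h u"
        using conv t unfolding convex_fun_def by (metis diff_add_cancel diff_ge_0_iff_ge less_imp_le)
      then have "h (p + t *\<^sub>R d) \<le> ereal ((1 - t) * r + t * m)"
        by (simp add: r real d_def algebra_simps)
      then have "h p + ereal (q p) \<le> ereal ((1 - t) * r + t * m) + ereal (q (p + t *\<^sub>R d))"
        using le[of "p + t *\<^sub>R d"] by (meson add_right_mono order_trans)
      then have "r + q p \<le> (1 - t) * r + t * m + q (p + t *\<^sub>R d)" by (simp add: r)
      moreover have "q (p + t *\<^sub>R d) = q p + t * D + t * (t * (\<rho> / 2 * (norm d)\<^sup>2))"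
        unfolding q_def D_def power2_norm_eq_inner
        by (simp add: inner_simps algebra_simps inner_commute)
      ultimately have "0 \<le> t * ((m - r + D) + t * (\<rho> / 2 * (norm d)\<^sup>2))"
        by (simp add: algebra_simps)
      then show ?thesis using t(1) by (simp add: zero_le_mult_iff)
    qed
    have "((\<lambda>t. (m - r + D) + t * (\<rho> / 2 * (norm d)\<^sup>2)) \<longlongrightarrow> (m - r + D) + 0 * (\<rho> / 2 * (norm d)\<^sup>2)) (at_right 0)"
      by (intro tendsto_intros)
    moreover have "eventually (\<lambda>t. 0 \<le> (m - r + D) + t * (\<rho> / 2 * (norm d)\<^sup>2)) (at_right (0::real))"
      using bound by (auto simp: eventually_at_right_field intro!: exI[of _ 1])
    ultimately have "0 \<le> m - r + D"
      using tendsto_lowerbound[of _ "m - r + D" "at_right (0::real)" 0] by simp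
    then show ?thesis by (simp add: r real D_def d_def inner_simps algebra_simps)
  next
    case MInf
    then show ?thesis using proper by (auto simp: proper_fun_def)
  qed auto
  then show ?thesis by (auto simp: subdiff_def r)
qed

text \<open>Adding the inequality from \<open>a\<close> to \<open>b\<close> and the one from
  \<open>b\<close> to \<open>a\<close> cancels the function values. Strong convexity is a hypothesis
  on \<open>h\<close>, so that \<open>\<mu> = 0\<close> yields plain monotonicity for the
  conjugate.\<close>

lemma subdiff_strongly_monotone:
  assumes proper: "proper_fun h"
    and sc: "\<And>x y v. v \<in> subdiff h x \<Longrightarrow>
      h y \<ge> h x + ereal (v \<bullet> (y - x) + \<mu> / 2 * (norm (y - x))\<^sup>2)"
    and v: "v \<in> subdiff h a" and w: "w \<in> subdiff h b"
  shows "\<mu> * (norm (a - b))\<^sup>2 \<le> (v - w) \<bullet> (a - b)"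
proof -
  obtain r where r: "h a = ereal r"
    using v proper by (cases "h a") (auto simp: subdiff_def proper_fun_def)
  obtain t where t: "h b = ereal t"
    using w proper by (cases "h b") (auto simp: subdiff_def proper_fun_def)
  show ?thesis
    using sc[OF v, of b] sc[OF w, of a]
    by (simp add: r t inner_simps norm_minus_commute[of b a] algebra_simps)
qed

text \<open>Once both functions are known to be finite at the saddle point, each saddle inequality
  has one function's value on both sides; cancelling it leaves a subgradient inequality for the
  other.\<close>

lemma saddle_point_lagrangian_subdiff:
  assumes pf: "proper_fun f" and pg: "proper_fun (convex_conjugate g)"
    and saddle: "saddle_point (lagrangian f g F) xs ys"
  shows "- (ys v* F) \<in> subdiff f xs" "F *v xs \<in> subdiff (convex_conjugate g) ys"
proof -
  let ?G = "convex_conjugate g"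
  have ly: "lagrangian f g F xs y \<le> lagrangian f g F xs ys" for y
    using saddle by (auto simp: saddle_point_def)
  have lx: "lagrangian f g F xs ys \<le> lagrangian f g F x ys" for x
    using saddle by (auto simp: saddle_point_def)
  obtain x0 a where x0: "f x0 = ereal a"
    using pf unfolding proper_fun_def by (metis ereal_cases)
  obtain y0 b where y0: "?G y0 = ereal b"
    using pg unfolding proper_fun_def by (metis ereal_cases)
  have fm: "f u \<noteq> -\<infinity>" for u using pf by (auto simp: proper_fun_def)
  have gm: "?G u \<noteq> -\<infinity>" for u using pg by (auto simp: proper_fun_def)
  \<comment> \<open>With \<open>\<infinity> - \<infinity> = \<infinity>\<close>, an infinite
    \<open>f xs\<close> makes the Lagrangian \<open>\<infinity>\<close> at the saddle point, yet
    moving to \<open>x0\<close> keeps it below \<open>\<infinity>\<close>.\<close>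
  have "f xs \<noteq> \<infinity>"
  proof
    assume "f xs = \<infinity>"
    then show False using lx[of x0] x0 gm[of ys] by (cases "?G ys") (auto simp: lagrangian_def)
  qed
  then obtain r where r: "f xs = ereal r" using fm[of xs] by (cases "f xs") auto
  have "?G ys \<noteq> \<infinity>"
  proof
    assume "?G ys = \<infinity>"
    then show False using ly[of y0] y0 r by (auto simp: lagrangian_def)
  qed
  then obtain t where t: "?G ys = ereal t" using gm[of ys] by (cases "?G ys") auto
  have "f xs + ereal (- (ys v* F) \<bullet> (u - xs)) \<le> f u" for u
    using lx[of u] fm[of u]
    by (cases "f u") (auto simp: lagrangian_def r t dot_lmul_matrix inner_diff_right inner_commute[of ys])
  then show "- (ys v* F) \<in> subdiff f xs" by (auto simp: subdiff_def r)
  have "?G ys + ereal ((F *v xs) \<bullet> (u - ys)) \<le> ?G u" for u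
    using ly[of u] gm[of u]
    by (cases "?G u") (auto simp: lagrangian_def r t inner_simps)
  then show "F *v xs \<in> subdiff ?G ys" by (auto simp: subdiff_def t)
qed

section \<open>Young's inequality and the one-step energy descent\<close>

text \<open>The norm condition gives \<open>norm (F *v d) \<le> norm d / s\<close>; after
  Cauchy-Schwarz, \<open>2 a b \<le> a^2 + b^2\<close> is used with
  \<open>a = \<bar>\<beta>\<bar> * norm d\<close> and \<open>b = norm q / s\<close>.\<close>

lemma inner_matrix_young:
  fixes F :: "real^'n^'m"
  assumes "s > 0" "s\<^sup>2 * (onorm (\<lambda>v. F *v v))\<^sup>2 \<le> 1"
  shows "\<bar>(F *v d) \<bullet> q\<bar> * \<beta> \<le> (norm q)\<^sup>2 / (2 * s\<^sup>2) + \<beta>\<^sup>2 * (norm d)\<^sup>2 / 2"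
proof -
  have "s * onorm (\<lambda>v. F *v v) \<le> 1"
    using assms(2) by (simp add: power_mult_distrib[symmetric] power2_le_iff_abs_le abs_square_le_1)
  then have "s * onorm (\<lambda>v. F *v v) * norm d \<le> 1 * norm d"
    by (intro mult_right_mono) auto
  moreover have "s * norm (F *v d) \<le> s * (onorm (\<lambda>v. F *v v) * norm d)"
    using assms(1) by (intro mult_left_mono onorm matrix_vector_mul_bounded_linear) auto
  ultimately have "s * norm (F *v d) \<le> norm d" by (simp add: mult.assoc)
  then have "norm (F *v d) \<le> norm d / s" using assms(1) by (simp add: field_simps)
  then have "\<bar>(F *v d) \<bullet> q\<bar> \<le> norm d / s * norm q"
    by (meson Cauchy_Schwarz_ineq2 order_trans mult_right_mono norm_ge_zero)
  then have "\<bar>(F *v d) \<bullet> q\<bar> * \<bar>\<beta>\<bar> \<le> (norm d / s * norm q) * \<bar>\<beta>\<bar>"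
    by (rule mult_right_mono) simp
  also have "\<dots> = (\<bar>\<beta>\<bar> * norm d) * (norm q / s)" by simp
  also have "\<dots> \<le> ((\<bar>\<beta>\<bar> * norm d)\<^sup>2 + (norm q / s)\<^sup>2) / 2"
    using sum_squares_bound[of "\<bar>\<beta>\<bar> * norm d" "norm q / s"]
    by (simp only: mult.assoc le_divide_eq_numeral1 mult.commute[of _ 2])
  also have "\<dots> = (norm q)\<^sup>2 / (2 * s\<^sup>2) + \<beta>\<^sup>2 * (norm d)\<^sup>2 / 2"
    by (simp add: power_mult_distrib power_divide add_divide_distrib)
  finally show ?thesis
    by (smt (verit) abs_ge_self abs_ge_zero mult_left_mono)
qed

lemma energy_ge:
  assumes "s > 0" "s\<^sup>2 * (onorm (\<lambda>v. F *v v))\<^sup>2 \<le> 1"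
  shows "(norm (x k - xs))\<^sup>2 / (2 * (\<tau> k)\<^sup>2) \<le> energy F s \<tau> xs ys x y k"
proof -
  have "- ((F *v (x k - x (k - 1))) \<bullet> (y (k - 1) - ys)) * (1 / \<tau> (k - 1))
    \<le> \<bar>(F *v (x k - x (k - 1))) \<bullet> (y (k - 1) - ys)\<bar> * \<bar>1 / \<tau> (k - 1)\<bar>"
    by (metis abs_ge_self abs_minus_cancel abs_mult)
  also note inner_matrix_young[OF assms]
  finally show ?thesis by (simp add: energy_def power_divide)
qed

text \<open>The hypotheses \<open>dual\<close> and \<open>primal\<close> are the monotonicity inequalities of the two
  proximal steps, scaled by \<open>1 / \<tau>\<^sub>k\<close> with \<open>\<alpha> = 1 / \<tau>\<^sub>k\<close> and \<open>\<beta> = 1 / \<tau>\<^sub>k\<^sub>-\<^sub>1\<close>; in their sum the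
  coupling terms telescope up to \<open>F (B - C) \<bullet> (p - q)\<close>, which Young's inequality absorbs.\<close>

lemma descent_inequality:
  fixes F :: "real^'n^'m"
  assumes s: "s > 0" "s\<^sup>2 * (onorm (\<lambda>v. F *v v))\<^sup>2 \<le> 1"
    and \<beta>: "\<beta> \<ge> 0"
    and primal: "\<alpha> * (\<mu> * (norm A)\<^sup>2) \<le> - \<alpha> * ((F *v A) \<bullet> p) - \<alpha>\<^sup>2 * ((A - B) \<bullet> A)"
    and dual: "0 \<le> \<alpha> * ((F *v B) \<bullet> p) + \<beta> * ((F *v (B - C)) \<bullet> p) - (p - q) \<bullet> p / s\<^sup>2"
    and \<gamma>: "\<gamma>\<^sup>2 \<le> \<alpha>\<^sup>2 + 2 * \<alpha> * \<mu>"
  shows "\<gamma>\<^sup>2 * (norm A)\<^sup>2 / 2 + (norm p)\<^sup>2 / (2 * s\<^sup>2) + \<alpha> * ((F *v (A - B)) \<bullet> p)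
      + \<alpha>\<^sup>2 * (norm (A - B))\<^sup>2 / 2
    \<le> \<alpha>\<^sup>2 * (norm B)\<^sup>2 / 2 + (norm q)\<^sup>2 / (2 * s\<^sup>2) + \<beta> * ((F *v (B - C)) \<bullet> q)
      + \<beta>\<^sup>2 * (norm (B - C))\<^sup>2 / 2"
proof -
  have "\<gamma>\<^sup>2 * (norm A)\<^sup>2 / 2 \<le> (\<alpha>\<^sup>2 + 2 * \<alpha> * \<mu>) * (norm A)\<^sup>2 / 2"
    using \<gamma> by (simp add: mult_right_mono)
  moreover have "(\<alpha>\<^sup>2 + 2 * \<alpha> * \<mu>) * (norm A)\<^sup>2 / 2 = \<alpha>\<^sup>2 * (norm A)\<^sup>2 / 2 + \<alpha> * (\<mu> * (norm A)\<^sup>2)"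
    by (simp add: field_simps)
  \<comment> \<open>The \<open>p - q\<close> part of this bound is paid by the polarization identity
    for \<open>(p - q) \<bullet> p\<close> below, the \<open>B - C\<close> part by the last term of
    the old energy.\<close>
  moreover have "\<beta> * ((F *v (B - C)) \<bullet> p) - \<beta> * ((F *v (B - C)) \<bullet> q)
    \<le> (norm (p - q))\<^sup>2 / (2 * s\<^sup>2) + \<beta>\<^sup>2 * (norm (B - C))\<^sup>2 / 2"
  proof -
    have "(F *v (B - C)) \<bullet> (p - q) * \<beta> \<le> \<bar>(F *v (B - C)) \<bullet> (p - q)\<bar> * \<beta>"
      using \<beta> by (intro mult_right_mono) auto
    also note inner_matrix_young[OF s]
    finally show ?thesis by (simp add: inner_simps algebra_simps)
  qed
  moreover have "(p - q) \<bullet> p / s\<^sup>2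
    = (norm p)\<^sup>2 / (2 * s\<^sup>2) - (norm q)\<^sup>2 / (2 * s\<^sup>2) + (norm (p - q))\<^sup>2 / (2 * s\<^sup>2)"
    using s(1) unfolding power2_norm_eq_inner
    by (simp add: inner_simps field_simps inner_commute)
  moreover have "\<alpha>\<^sup>2 * ((A - B) \<bullet> A)
    = \<alpha>\<^sup>2 * (norm A)\<^sup>2 / 2 - \<alpha>\<^sup>2 * (norm B)\<^sup>2 / 2 + \<alpha>\<^sup>2 * (norm (A - B))\<^sup>2 / 2"
    unfolding power2_norm_eq_inner by (simp add: inner_simps field_simps inner_commute)
  moreover have "\<alpha> * ((F *v (A - B)) \<bullet> p) = \<alpha> * ((F *v A) \<bullet> p) - \<alpha> * ((F *v B) \<bullet> p)"
    by (simp add: matrix_vector_mult_diff_distrib inner_simps algebra_simps)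
  ultimately show ?thesis using primal dual unfolding mult_minus_left by linarith
qed

section \<open>Convergence rate of the accelerated iteration\<close>

theorem theorem4p2:
  fixes f :: "real^'n \<Rightarrow> ereal" and g :: "real^'m \<Rightarrow> ereal" and F :: "real^'n^'m"
    and \<mu> s c :: real
    and \<tau> \<sigma> \<theta> :: "nat \<Rightarrow> real"
    and x :: "nat \<Rightarrow> real^'n" and y :: "nat \<Rightarrow> real^'m"
    and xs :: "real^'n" and ys :: "real^'m"
    and K0 :: nat
  assumes mu_pos: "\<mu> > 0"
    and f: "f \<in> strongly_convex_funs \<mu>"
    and g: "g \<in> closed_convex_funs"
    and s_pos: "s > 0"
    and s_less: "s\<^sup>2 * (onorm (\<lambda>v. F *v v))\<^sup>2 < 1"
    and c: "0 < c" "c < \<mu>"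
    and saddle: "saddle_point (lagrangian f g F) xs ys"
    and iter: "pdhg f g F \<tau> \<sigma> \<theta> x y"
    and tau: "\<And>k. k \<ge> 1 \<Longrightarrow> \<tau> k = 1 / (c * real k)"
    and tau0: "\<tau> 0 > \<tau> 1"
    and sigma: "\<And>k. \<sigma> k = c * s\<^sup>2 * (real k + 1)"
    and theta: "\<And>k. \<theta> k = \<tau> (k + 1) / \<tau> k"
    and K0: "K0 = nat \<lceil>c / (2 * \<mu> - 2 * c)\<rceil>"
  shows "(\<forall>k. 0 < \<theta> k \<and> \<theta> k < 1) \<and>
    (\<forall>k. \<tau> (k + 1) * \<sigma> k = s\<^sup>2) \<and>
    K0 > 0 \<and>
    (\<forall>k\<ge>K0. (norm (x k - xs))\<^sup>2 \<le> 2 * energy F s \<tau> xs ys x y K0 / (c\<^sup>2 * (real k)\<^sup>2)) \<and>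
    (c \<le> 2 * \<mu> / 3 \<longrightarrow>
      (\<forall>k\<ge>1. (norm (x k - xs))\<^sup>2 \<le> 2 / (c\<^sup>2 * (real k)\<^sup>2) *
        ((norm (x 1 - xs))\<^sup>2 / (2 * (\<tau> 1)\<^sup>2)
         + (norm (y 0 - ys))\<^sup>2 / (2 * s\<^sup>2)
         + ((F *v (x 1 - x 0)) \<bullet> (y 0 - ys)) / \<tau> 0
         + (norm (x 1 - x 0))\<^sup>2 / (2 * (\<tau> 0)\<^sup>2))))"
proof -
  let ?G = "convex_conjugate g" and ?E = "energy F s \<tau> xs ys x y"
  have pf: "proper_fun f" and cf: "convex_fun f"
    using f by (auto simp: strongly_convex_funs_def closed_convex_funs_def)
  have pg: "proper_fun ?G" and cg: "convex_fun ?G"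
    using convex_conjugate_proper[OF g] convex_conjugate_convex by auto
  have s: "s\<^sup>2 * (onorm (\<lambda>v. F *v v))\<^sup>2 \<le> 1" using s_less by simp
  have tauS: "\<tau> (k + 1) = 1 / (c * (real k + 1))" for k using tau[of "k + 1"] by simp
  have tau_pos: "\<tau> k > 0" for k
  proof (cases k)
    case 0
    have "\<tau> 1 > 0" using tauS[of 0] c by simp
    then show ?thesis using tau0 0 by simp
  next
    case (Suc n)
    then show ?thesis using tauS[of n] c by simp
  qed
  have tau_dec: "\<tau> (k + 1) < \<tau> k" for k
  proof (cases k)
    case (Suc n)
    have "1 / (c * (real k + 1)) < 1 / (c * (real n + 1))"
      using Suc c by (intro divide_strict_left_mono) auto
    then show ?thesis using tauS[of k] tauS[of n] Suc by simp
  qed (use tau0 in simp)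
  have theta01: "0 < \<theta> k \<and> \<theta> k < 1" for k
    using tau_pos[of k] tau_pos[of "k + 1"] tau_dec[of k] by (simp add: theta)
  have ts: "\<tau> (k + 1) * \<sigma> k = s\<^sup>2" for k
  proof -
    have "c * (real k + 1) \<noteq> 0" using c(1) by simp
    then show ?thesis unfolding tauS sigma by (simp add: mult.commute mult.left_commute)
  qed
  have sig_pos: "\<sigma> k > 0" for k using sigma[of k] c s_pos by simp
  have K0_pos: "K0 > 0" using c by (simp add: K0)
  have K0_ge: "c / (2 * \<mu> - 2 * c) \<le> real K0" by (simp add: K0 of_nat_ceiling)

  note saddle_sub = saddle_point_lagrangian_subdiff[OF pf pg saddle]
  have xsub: "- (y k v* F) - (1 / \<tau> k) *\<^sub>R (x (Suc k) - x k) \<in> subdiff f (x (Suc k))" for k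
  proof (rule arg_min_prox_subdiff[OF pf cf])
    show "is_arg_min (\<lambda>u. f u + ereal ((y k v* F) \<bullet> u + 1 / \<tau> k / 2 * (norm (u - x k))\<^sup>2))
        (\<lambda>_. True) (x (Suc k))"
      using iter[unfolded pdhg_def, rule_format, of k]
      by (simp add: dot_lmul_matrix inner_commute[of "y k"] mult.commute)
  qed
  have ysub: "F *v (x (Suc k) + \<theta> k *\<^sub>R (x (Suc k) - x k)) - (1 / \<sigma> k) *\<^sub>R (y (Suc k) - y k)
      \<in> subdiff ?G (y (Suc k))" for k
  proof -
    define z where "z = F *v (x (Suc k) + \<theta> k *\<^sub>R (x (Suc k) - x k))"
    \<comment> \<open>The maximization becomes a minimization by negation, which distributes over
      the sum because the second summand is finite.\<close>
    have neg: "- ?G v + ereal (z \<bullet> v - 1 / (2 * \<sigma> k) * (norm (v - y k))\<^sup>2)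
      = - (?G v + ereal ((- z) \<bullet> v + 1 / \<sigma> k / 2 * (norm (v - y k))\<^sup>2))" for v
      by (cases "?G v") (auto simp: algebra_simps)
    have "is_arg_min (\<lambda>v. ?G v + ereal ((- z) \<bullet> v + 1 / \<sigma> k / 2 * (norm (v - y k))\<^sup>2))
        (\<lambda>_. True) (y (Suc k))"
      using iter[unfolded pdhg_def, rule_format, of k] unfolding Let_def z_def[symmetric] neg
      by (simp add: is_arg_min_def is_arg_max_def)
    from arg_min_prox_subdiff[OF pg cg this] show ?thesis by (simp add: z_def)
  qed

  have step: "?E (Suc k) \<le> ?E k" if k: "k \<ge> K0" for k
  proof -
    \<comment> \<open>The primal step \<open>k\<close> is paired with the dual step
      \<open>j = k - 1\<close>, which produces \<open>y k\<close>; both inequalities are then tested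
      against the same \<open>p = y k - ys\<close>.\<close>
    obtain j where j: "k = Suc j" using k K0_pos by (cases k) auto
    define A B C where "A = x (Suc k) - xs" and "B = x k - xs" and "C = x j - xs"
    define p q where "p = y k - ys" and "q = y j - ys"
    define \<alpha> \<beta> \<gamma> where "\<alpha> = 1 / \<tau> k" and "\<beta> = 1 / \<tau> j" and "\<gamma> = 1 / \<tau> (Suc k)"
    have AB: "x (Suc k) - x k = A - B" and BC: "x k - x j = B - C" and pq: "y k - y j = p - q"
      by (simp_all add: A_def B_def C_def p_def q_def)
    have pos: "\<alpha> > 0" "\<beta> > 0" by (simp_all add: \<alpha>_def \<beta>_def tau_pos)
    have "\<mu> * (norm A)\<^sup>2 \<le> (- (y k v* F) - \<alpha> *\<^sub>R (A - B) - - (ys v* F)) \<bullet> A"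
      using subdiff_strongly_monotone[OF pf _ xsub[of k] saddle_sub(1), of \<mu>] f
      unfolding strongly_convex_funs_def A_def[symmetric] AB \<alpha>_def by auto
    also have "\<dots> = - ((F *v A) \<bullet> p) - \<alpha> * ((A - B) \<bullet> A)"
    proof -
      have "(w v* F) \<bullet> A = (F *v A) \<bullet> w" for w
        by (metis dot_lmul_matrix inner_commute)
      then show ?thesis by (simp add: inner_diff_left inner_add_left p_def inner_diff_right)
    qed
    finally have "\<alpha> * (\<mu> * (norm A)\<^sup>2) \<le> \<alpha> * (- ((F *v A) \<bullet> p) - \<alpha> * ((A - B) \<bullet> A))"
      using pos(1) by (intro mult_left_mono) auto
    then have primal: "\<alpha> * (\<mu> * (norm A)\<^sup>2) \<le> - \<alpha> * ((F *v A) \<bullet> p) - \<alpha>\<^sup>2 * ((A - B) \<bullet> A)"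
      by (simp add: right_diff_distrib power2_eq_square mult.assoc)
    have "0 \<le> (F *v (x k + \<theta> j *\<^sub>R (B - C)) - (1 / \<sigma> j) *\<^sub>R (p - q) - F *v xs) \<bullet> p"
      using subdiff_strongly_monotone[OF pg _ ysub[of j] saddle_sub(2), of 0]
      unfolding j[symmetric] p_def[symmetric] BC pq by (auto simp: subdiff_def)
    also have "\<dots> = (F *v B) \<bullet> p + \<theta> j * ((F *v (B - C)) \<bullet> p) - (p - q) \<bullet> p / \<sigma> j"
      by (simp add: B_def matrix_vector_mult_add_rdistrib matrix_vector_right_distrib
          matrix_vector_mult_diff_distrib matrix_vector_mult_scaleR inner_diff_left inner_add_left)
    finally have "0 \<le> \<alpha> * ((F *v B) \<bullet> p + \<theta> j * ((F *v (B - C)) \<bullet> p) - (p - q) \<bullet> p / \<sigma> j)"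
      using pos(1) by simp
    \<comment> \<open>This is where the parameter coupling enters:
      \<open>\<theta> j = \<tau> k / \<tau> j\<close> turns the extrapolation weight into
      \<open>\<beta>\<close>, and \<open>\<tau> k * \<sigma> j = s^2\<close> makes the dual weight
      constant.\<close>
    moreover have "\<alpha> * \<theta> j = \<beta>"
      using tau_pos[of k] by (simp add: \<alpha>_def \<beta>_def theta j)
    moreover have "\<alpha> * (r / \<sigma> j) = r / s\<^sup>2" for r
      using ts[of j] by (simp add: \<alpha>_def j)
    ultimately have dual:
      "0 \<le> \<alpha> * ((F *v B) \<bullet> p) + \<beta> * ((F *v (B - C)) \<bullet> p) - (p - q) \<bullet> p / s\<^sup>2"
      by (simp only: distrib_left right_diff_distrib mult.assoc[symmetric])
    have ac: "\<alpha> = c * real k" and gc: "\<gamma> = c * (real k + 1)"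
      using tauS[of j] tauS[of k] by (simp_all add: \<alpha>_def \<gamma>_def j algebra_simps)
    \<comment> \<open>The target is \<open>c^2 (k + 1)^2 \<le> c^2 k^2 + 2 c k \<mu>\<close>;
      expanding, it becomes \<open>c^2 \<le> c k (2 \<mu> - 2 c)\<close>, which is the threshold
      \<open>K0\<close> multiplied out.\<close>
    have "c / (2 * \<mu> - 2 * c) \<le> real k" using K0_ge k by linarith
    then have "c \<le> real k * (2 * \<mu> - 2 * c)" using c by (simp add: field_simps)
    then have "c * c \<le> c * (real k * (2 * \<mu> - 2 * c))" using c by simp
    then have \<gamma>: "\<gamma>\<^sup>2 \<le> \<alpha>\<^sup>2 + 2 * \<alpha> * \<mu>"
      unfolding ac gc by (simp add: power2_eq_square algebra_simps)
    have "?E (Suc k) = \<gamma>\<^sup>2 * (norm A)\<^sup>2 / 2 + (norm p)\<^sup>2 / (2 * s\<^sup>2)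
        + \<alpha> * ((F *v (A - B)) \<bullet> p) + \<alpha>\<^sup>2 * (norm (A - B))\<^sup>2 / 2"
      by (simp add: energy_def AB \<alpha>_def \<gamma>_def power_divide flip: A_def p_def)
    moreover have "?E k = \<alpha>\<^sup>2 * (norm B)\<^sup>2 / 2 + (norm q)\<^sup>2 / (2 * s\<^sup>2)
        + \<beta> * ((F *v (B - C)) \<bullet> q) + \<beta>\<^sup>2 * (norm (B - C))\<^sup>2 / 2"
      by (simp add: energy_def \<alpha>_def \<beta>_def power_divide j B_def C_def q_def)
    ultimately show ?thesis
      using descent_inequality[OF s_pos s _ primal dual \<gamma>] pos by simp
  qed
  have rate: "(norm (x k - xs))\<^sup>2 \<le> 2 * ?E K0 / (c\<^sup>2 * (real k)\<^sup>2)" if k: "k \<ge> K0" for k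
  proof -
    \<comment> \<open>The formula for \<open>\<tau> k\<close> starts at \<open>k = 1\<close>; it
      turns the first energy term into \<open>c^2 k^2 / 2\<close> times the squared
      distance.\<close>
    have kp: "k \<ge> 1" using k K0_pos by simp
    have "(norm (x k - xs))\<^sup>2 / (2 * (\<tau> k)\<^sup>2) \<le> ?E k" by (rule energy_ge[OF s_pos s])
    also have "?E k \<le> ?E K0"
      using k by (induction rule: dec_induct) (use step order_trans in blast)+
    finally have "(norm (x k - xs))\<^sup>2 * (c\<^sup>2 * (real k)\<^sup>2) \<le> 2 * ?E K0"
      by (simp add: tau[OF kp] power_divide power_mult_distrib)
    then show ?thesis using c kp by (simp add: pos_le_divide_eq)
  qed
  \<comment> \<open>The condition \<open>3 c \<le> 2 \<mu>\<close> says
    \<open>c \<le> 2 \<mu> - 2 c\<close>, so the quotient under the ceiling is at most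
    \<open>1\<close>; the displayed bound is then the energy at \<open>1\<close> written
    out.\<close>
  have "K0 = 1" if "c \<le> 2 * \<mu> / 3"
  proof -
    have "c / (2 * \<mu> - 2 * c) \<le> 1" using that c by (simp add: field_simps)
    then have "K0 \<le> 1" by (simp add: K0 ceiling_le_iff)
    then show ?thesis using K0_pos by simp
  qed
  then show ?thesis
    using theta01 ts K0_pos rate by (auto simp: energy_def)
qed

end
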